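(* The proof system $\mathbf{SC}$ is complete with respect to the class of proper partial epistemic models with no empty world: every formula of $\mathcal L_D$ that is true at every world of every proper partial epistemic model with no empty world is provable in $\mathbf{SC}$.
   Context: Fix a finite set $A$ of agents and a countable set $\mathsf{AP}$. $\mathcal L_D$: $\varphi::=p\mid\neg\varphi\mid\varphi\wedge\varphi\mid D_B\varphi$, $p\in\mathsf{AP}$, $\emptyset\ne B\subseteq A$; $K_a\varphi:=D_{\{a\}}\varphi$, $\mathsf{dead}(a):=K_a\bot$, $\mathsf{alive}(a):=\neg\mathsf{dead}(a)$, $\mathsf{dead}(B):=\bigwedge_{a\in B}\mathsf{dead}(a)$, $\mathsf{alive}(B):=\neg D_B\bot$, $\overline B=A\setminus B$. $\mathbf{SC}$: propositional tautologies, modus ponens, necessitation (from $\varphi$ infer $D_B\varphi$), and for non-empty $B,B'$: $D_B(\varphi\Rightarrow\psi)\Rightarrow(D_B\varphi\Rightarrow D_B\psi)$; $\varphi\Rightarrow D_B\neg D_B\neg\varphi$; $D_B\varphi\Rightarrow D_BD_B\varphi$; $D_B\varphi\Rightarrow D_{B'}\varphi$ ($B\subseteq B'$); $\mathsf{alive}(B)\wedge\mathsf{alive}(B')\Rightarrow\mathsf{alive}(B\cup B')$; $\bigvee_{a\in A}\mathsf{alive}(a)$; $\mathsf{alive}(B)\wedge\mathsf{dead}(\overline B)\wedge\varphi\Rightarrow D_B(\mathsf{dead}(\overline B)\Rightarrow\varphi)$. A partial epistemic model is $M=\langle W,\sim,L\rangle$ with each $\sim_a$ ($a\in A$) a symmetric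 transitive relation on $W$ and $L:W\to\mathcal P(\mathsf{AP})$; satisfaction: $p$ at $w$ iff $p\in L(w)$, boolean clauses standard, $D_B\varphi$ at $w$ iff $\varphi$ at all $w'$ with $w\sim_aw'$ for all $a\in B$. $\mathrm{live}(w)=\{a:w\sim_aw\}$; no empty world: $\mathrm{live}(w)\ne\emptyset$ for all $w$; proper: for $w\ne w'$ with $\mathrm{live}(w)=\mathrm{live}(w')$ there is $a\in\mathrm{live}(w)$ with $w\not\sim_aw'$. *)

theory Defs
  imports Main "HOL-Library.Countable_Set"
begin

datatype ('a, 'p) fm =
    Atom 'p
  | Neg "('a, 'p) fm"
  | And "('a, 'p) fm" "('a, 'p) fm"
  | Dist "'a set" "('a, 'p) fm"

text \<open>The language over agents \<open>A\<close> and atoms \<open>AP\<close>; it is empty when \<open>AP\<close> is.\<close>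

primrec wff :: "'a set \<Rightarrow> 'p set \<Rightarrow> ('a, 'p) fm \<Rightarrow> bool" where
  "wff A AP (Atom p) \<longleftrightarrow> p \<in> AP"
| "wff A AP (Neg \<phi>) \<longleftrightarrow> wff A AP \<phi>"
| "wff A AP (And \<phi> \<psi>) \<longleftrightarrow> wff A AP \<phi> \<and> wff A AP \<psi>"
| "wff A AP (Dist B \<phi>) \<longleftrightarrow> B \<noteq> {} \<and> B \<subseteq> A \<and> wff A AP \<phi>"

definition Imp :: "('a, 'p) fm \<Rightarrow> ('a, 'p) fm \<Rightarrow> ('a, 'p) fm" where
  "Imp \<phi> \<psi> = Neg (And \<phi> (Neg \<psi>))"

definition Or :: "('a, 'p) fm \<Rightarrow> ('a, 'p) fm \<Rightarrow> ('a, 'p) fm" where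
  "Or \<phi> \<psi> = Neg (And (Neg \<phi>) (Neg \<psi>))"

text \<open>The grammar has no constant for falsity, so it is \<open>p \<and> \<not> p\<close> for a fixed atom
  \<open>p\<close> of \<open>AP\<close>.\<close>

definition Bot :: "'p set \<Rightarrow> ('a, 'p) fm" where
  "Bot AP = (let p = Atom (SOME p. p \<in> AP) in And p (Neg p))"

definition Top :: "'p set \<Rightarrow> ('a, 'p) fm" where
  "Top AP = Neg (Bot AP)"

text \<open>Conjunctions and disjunctions over a finite set are taken in a fixed but arbitrary
  order; the empty ones are \<open>Top\<close> and \<open>Bot\<close>.\<close>

definition enum_of :: "'b set \<Rightarrow> 'b list" where
  "enum_of S = (SOME xs. distinct xs \<and> set xs = S)"

definition Conj :: "'p set \<Rightarrow> 'b set \<Rightarrow> ('b \<Rightarrow> ('a, 'p) fm) \<Rightarrow> ('a, 'p) fm" where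
  "Conj AP S f = foldr (\<lambda>x. And (f x)) (enum_of S) (Top AP)"

definition Disj :: "'p set \<Rightarrow> 'b set \<Rightarrow> ('b \<Rightarrow> ('a, 'p) fm) \<Rightarrow> ('a, 'p) fm" where
  "Disj AP S f = foldr (\<lambda>x. Or (f x)) (enum_of S) (Bot AP)"

definition K :: "'a \<Rightarrow> ('a, 'p) fm \<Rightarrow> ('a, 'p) fm" where
  "K a \<phi> = Dist {a} \<phi>"

definition dead :: "'p set \<Rightarrow> 'a \<Rightarrow> ('a, 'p) fm" where
  "dead AP a = K a (Bot AP)"

definition alive :: "'p set \<Rightarrow> 'a \<Rightarrow> ('a, 'p) fm" where
  "alive AP a = Neg (dead AP a)"

definition dead_set :: "'p set \<Rightarrow> 'a set \<Rightarrow> ('a, 'p) fm" where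
  "dead_set AP B = Conj AP B (dead AP)"

definition alive_set :: "'p set \<Rightarrow> 'a set \<Rightarrow> ('a, 'p) fm" where
  "alive_set AP B = Neg (Dist B (Bot AP))"

text \<open>Truth-functional evaluation: atoms and modal formulas act as propositional variables.\<close>

primrec prop_eval :: "(('a, 'p) fm \<Rightarrow> bool) \<Rightarrow> ('a, 'p) fm \<Rightarrow> bool" where
  "prop_eval v (Atom p) \<longleftrightarrow> v (Atom p)"
| "prop_eval v (Neg \<phi>) \<longleftrightarrow> \<not> prop_eval v \<phi>"
| "prop_eval v (And \<phi> \<psi>) \<longleftrightarrow> prop_eval v \<phi> \<and> prop_eval v \<psi>"
| "prop_eval v (Dist B \<phi>) \<longleftrightarrow> v (Dist B \<phi>)"

definition tautology :: "('a, 'p) fm \<Rightarrow> bool" where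
  "tautology \<phi> \<longleftrightarrow> (\<forall>v. prop_eval v \<phi>)"

definition coalition :: "'a set \<Rightarrow> 'a set \<Rightarrow> bool" where
  "coalition A B \<longleftrightarrow> B \<noteq> {} \<and> B \<subseteq> A"

inductive SC :: "'a set \<Rightarrow> 'p set \<Rightarrow> ('a, 'p) fm \<Rightarrow> bool" for A AP where
  Taut: "wff A AP \<phi> \<Longrightarrow> tautology \<phi> \<Longrightarrow> SC A AP \<phi>"
| MP: "SC A AP (Imp \<phi> \<psi>) \<Longrightarrow> SC A AP \<phi> \<Longrightarrow> SC A AP \<psi>"
| Nec: "coalition A B \<Longrightarrow> SC A AP \<phi> \<Longrightarrow> SC A AP (Dist B \<phi>)"
| AxK: "coalition A B \<Longrightarrow> wff A AP \<phi> \<Longrightarrow> wff A AP \<psi> \<Longrightarrow>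
    SC A AP (Imp (Dist B (Imp \<phi> \<psi>)) (Imp (Dist B \<phi>) (Dist B \<psi>)))"
| AxB: "coalition A B \<Longrightarrow> wff A AP \<phi> \<Longrightarrow>
    SC A AP (Imp \<phi> (Dist B (Neg (Dist B (Neg \<phi>)))))"
| Ax4: "coalition A B \<Longrightarrow> wff A AP \<phi> \<Longrightarrow>
    SC A AP (Imp (Dist B \<phi>) (Dist B (Dist B \<phi>)))"
| AxMono: "coalition A B \<Longrightarrow> coalition A B' \<Longrightarrow> B \<subseteq> B' \<Longrightarrow> wff A AP \<phi> \<Longrightarrow>
    SC A AP (Imp (Dist B \<phi>) (Dist B' \<phi>))"
| AxUnion: "coalition A B \<Longrightarrow> coalition A B' \<Longrightarrow> AP \<noteq> {} \<Longrightarrow>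
    SC A AP (Imp (And (alive_set AP B) (alive_set AP B')) (alive_set AP (B \<union> B')))"
| AxNE: "AP \<noteq> {} \<Longrightarrow> SC A AP (Disj AP A (alive AP))"
| AxP: "coalition A B \<Longrightarrow> wff A AP \<phi> \<Longrightarrow>
    SC A AP (Imp (And (And (alive_set AP B) (dead_set AP (A - B))) \<phi>)
                 (Dist B (Imp (dead_set AP (A - B)) \<phi>)))"

text \<open>\<open>AP \<noteq> {}\<close> in two of the axioms is exactly the condition that they are formulas of the
  language, as \<open>Bot\<close> occurs in them.\<close>

record ('w, 'a, 'p) model =
  worlds :: "'w set"
  rel :: "'a \<Rightarrow> ('w \<times> 'w) set"
  val :: "'w \<Rightarrow> 'p set"

definition partial_epistemic_model :: "'a set \<Rightarrow> 'p set \<Rightarrow> ('w, 'a, 'p) model \<Rightarrow> bool" where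
  "partial_epistemic_model A AP M \<longleftrightarrow>
     (\<forall>a\<in>A. rel M a \<subseteq> worlds M \<times> worlds M \<and> sym (rel M a) \<and> trans (rel M a)) \<and>
     (\<forall>w\<in>worlds M. val M w \<subseteq> AP)"

primrec sat :: "('w, 'a, 'p) model \<Rightarrow> 'w \<Rightarrow> ('a, 'p) fm \<Rightarrow> bool" where
  "sat M w (Atom p) \<longleftrightarrow> p \<in> val M w"
| "sat M w (Neg \<phi>) \<longleftrightarrow> \<not> sat M w \<phi>"
| "sat M w (And \<phi> \<psi>) \<longleftrightarrow> sat M w \<phi> \<and> sat M w \<psi>"
| "sat M w (Dist B \<phi>) \<longleftrightarrow> (\<forall>w'\<in>worlds M. (\<forall>a\<in>B. (w, w') \<in> rel M a) \<longrightarrow> sat M w' \<phi>)"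

definition live :: "'a set \<Rightarrow> ('w, 'a, 'p) model \<Rightarrow> 'w \<Rightarrow> 'a set" where
  "live A M w = {a \<in> A. (w, w) \<in> rel M a}"

definition no_empty_world :: "'a set \<Rightarrow> ('w, 'a, 'p) model \<Rightarrow> bool" where
  "no_empty_world A M \<longleftrightarrow> (\<forall>w\<in>worlds M. live A M w \<noteq> {})"

definition proper :: "'a set \<Rightarrow> ('w, 'a, 'p) model \<Rightarrow> bool" where
  "proper A M \<longleftrightarrow>
     (\<forall>w\<in>worlds M. \<forall>w'\<in>worlds M. w \<noteq> w' \<and> live A M w = live A M w' \<longrightarrow>
        (\<exists>a\<in>live A M w. (w, w') \<notin> rel M a))"

text \<open>HOL cannot quantify over all types of worlds inside a formula, so validity is taken over
  all models whose worlds form a subset of a given type \<open>'w\<close>.\<close>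

definition valid_proper :: "'w itself \<Rightarrow> 'a set \<Rightarrow> 'p set \<Rightarrow> ('a, 'p) fm \<Rightarrow> bool" where
  "valid_proper (_ :: 'w itself) A AP \<phi> \<longleftrightarrow>
     (\<forall>M :: ('w, 'a, 'p) model.
        partial_epistemic_model A AP M \<and> no_empty_world A M \<and> proper A M \<longrightarrow>
        (\<forall>w\<in>worlds M. sat M w \<phi>))"

end

theory Submission
  imports Defs "HOL-Library.Sublist"
begin

text \<open>
  A non-theorem is refuted at some maximal consistent set. In the canonical structure, \<open>D\<^sub>B\<close> is
  interpreted by a relation \<open>R\<^sub>B\<close> of its own, which need not be the intersection of the relations
  of the members of \<open>B\<close>. It is therefore unravelled into a tree: a node is a list of refuted
  subformulas \<open>D\<^sub>B \<psi>\<close>, each of them naming an edge with label \<open>B\<close> to a chosen witness. Two nodes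
  are \<open>a\<close>-related if \<open>a\<close> is alive at both and the edges between them all have \<open>a\<close> in their label.
  As there is only one way between two nodes, nodes related by all members of \<open>B\<close> carry
  \<open>R\<^sub>B\<close>-related sets. The tree need not be proper, but by the last axiom two nodes that violate
  properness carry the same maximal consistent set, so they may be identified. Only finitely many
  subformulas serve as edges, so the tree is countable and embeds into any infinite type.
\<close>

section \<open>Propositional reasoning\<close>

abbreviation Imps :: "('a, 'p) fm list \<Rightarrow> ('a, 'p) fm \<Rightarrow> ('a, 'p) fm" where
  "Imps xs \<phi> \<equiv> foldr Imp xs \<phi>"

lemma wff_Imp [simp]: "wff A AP (Imp \<phi> \<psi>) \<longleftrightarrow> wff A AP \<phi> \<and> wff A AP \<psi>"
  by (simp add: Imp_def)

lemma wff_Imps [simp]: "wff A AP (Imps xs \<phi>) \<longleftrightarrow> (\<forall>x\<in>set xs. wff A AP x) \<and> wff A AP \<phi>"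
  by (induction xs) auto

lemma wff_Bot: "AP \<noteq> {} \<Longrightarrow> wff A AP (Bot AP)"
  by (simp add: Bot_def Let_def some_in_eq)

text \<open>The grammar has no constants, so every formula contains an atom.\<close>

lemma AP_nonempty_if_wff: "wff A AP \<phi> \<Longrightarrow> AP \<noteq> {}"
  by (induction \<phi>) auto

lemma prop_eval_Imp [simp]: "prop_eval v (Imp \<phi> \<psi>) \<longleftrightarrow> (prop_eval v \<phi> \<longrightarrow> prop_eval v \<psi>)"
  by (simp add: Imp_def)

lemma prop_eval_Imps [simp]:
  "prop_eval v (Imps xs \<phi>) \<longleftrightarrow> ((\<forall>x\<in>set xs. prop_eval v x) \<longrightarrow> prop_eval v \<phi>)"
  by (induction xs) auto

lemma prop_eval_Or [simp]: "prop_eval v (Or \<phi> \<psi>) \<longleftrightarrow> prop_eval v \<phi> \<or> prop_eval v \<psi>"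
  by (simp add: Or_def)

lemma prop_eval_Bot [simp]: "\<not> prop_eval v (Bot AP)"
  by (simp add: Bot_def Let_def)

lemma prop_eval_Top [simp]: "prop_eval v (Top AP)"
  by (simp add: Top_def)

lemma set_enum_of: "finite S \<Longrightarrow> set (enum_of S) = S"
  unfolding enum_of_def by (rule someI2_ex) (use finite_distinct_list in blast)+

lemma prop_eval_Conj:
  assumes "finite S"
  shows "prop_eval v (Conj AP S f) \<longleftrightarrow> (\<forall>x\<in>S. prop_eval v (f x))"
proof -
  have "prop_eval v (foldr (\<lambda>x. And (f x)) xs (Top AP)) \<longleftrightarrow> (\<forall>x\<in>set xs. prop_eval v (f x))" for xs
    by (induction xs) auto
  then show ?thesis
    using assms by (simp add: Conj_def set_enum_of)
qed

lemma prop_eval_Disj: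
  assumes "finite S"
  shows "prop_eval v (Disj AP S f) \<longleftrightarrow> (\<exists>x\<in>S. prop_eval v (f x))"
proof -
  have "prop_eval v (foldr (\<lambda>x. Or (f x)) xs (Bot AP)) \<longleftrightarrow> (\<exists>x\<in>set xs. prop_eval v (f x))" for xs
    by (induction xs) auto
  then show ?thesis
    using assms by (simp add: Disj_def set_enum_of)
qed

lemma wff_Conj:
  assumes "finite S" "AP \<noteq> {}" "\<And>x. x \<in> S \<Longrightarrow> wff A AP (f x)"
  shows "wff A AP (Conj AP S f)"
proof -
  have "\<forall>x\<in>set xs. wff A AP (f x) \<Longrightarrow> wff A AP (foldr (\<lambda>x. And (f x)) xs (Top AP))" for xs
    by (induction xs) (auto simp: Top_def wff_Bot assms(2))
  then show ?thesis
    using assms by (simp add: Conj_def set_enum_of)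
qed

lemma wff_Disj:
  assumes "finite S" "AP \<noteq> {}" "\<And>x. x \<in> S \<Longrightarrow> wff A AP (f x)"
  shows "wff A AP (Disj AP S f)"
proof -
  have "\<forall>x\<in>set xs. wff A AP (f x) \<Longrightarrow> wff A AP (foldr (\<lambda>x. Or (f x)) xs (Bot AP))" for xs
    by (induction xs) (auto simp: Or_def wff_Bot assms(2))
  then show ?thesis
    using assms by (simp add: Disj_def set_enum_of)
qed

section \<open>Maximal consistent sets\<close>

locale finite_agents =
  fixes A :: "'a set" and AP :: "'p set"
  assumes fin: "finite A" and AP_nonempty: "AP \<noteq> {}"
begin

lemma wff_Bot' [simp]: "wff A AP (Bot AP)"
  by (rule wff_Bot[OF AP_nonempty])

text \<open>The curried implication from \<open>ys\<close> to \<open>\<phi>\<close> is itself a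
  tautology; repeated \<open>MP\<close> then discharges the premises.\<close>

lemma SC_taut_consequence:
  assumes "\<And>y. y \<in> set ys \<Longrightarrow> SC A AP y" "\<And>y. y \<in> set ys \<Longrightarrow> wff A AP y" "wff A AP \<phi>"
    and "\<And>v. (\<And>y. y \<in> set ys \<Longrightarrow> prop_eval v y) \<Longrightarrow> prop_eval v \<phi>"
  shows "SC A AP \<phi>"
proof -
  have "SC A AP (Imps ys \<phi>)"
    using assms by (intro SC.Taut) (auto simp: tautology_def)
  then show ?thesis
    using assms(1) by (induction ys) (auto intro: SC.MP)
qed

definition consistent :: "('a, 'p) fm set \<Rightarrow> bool" where
  "consistent \<Gamma> \<longleftrightarrow> (\<forall>\<phi>\<in>\<Gamma>. wff A AP \<phi>) \<and> \<not> (\<exists>xs. set xs \<subseteq> \<Gamma> \<and> SC A AP (Imps xs (Bot AP)))"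

definition mcs :: "('a, 'p) fm set \<Rightarrow> bool" where
  "mcs \<Gamma> \<longleftrightarrow> consistent \<Gamma> \<and> (\<forall>\<Delta>. consistent \<Delta> \<longrightarrow> \<Gamma> \<subseteq> \<Delta> \<longrightarrow> \<Delta> = \<Gamma>)"

lemma Lindenbaum:
  assumes "consistent \<Gamma>"
  obtains \<Delta> where "mcs \<Delta>" "\<Gamma> \<subseteq> \<Delta>"
proof -
  let ?\<A> = "{\<Delta>. consistent \<Delta> \<and> \<Gamma> \<subseteq> \<Delta>}"
  have "\<exists>M\<in>?\<A>. \<forall>X\<in>?\<A>. M \<subseteq> X \<longrightarrow> X = M"
  proof (rule subset_Zorn_nonempty)
    show "?\<A> \<noteq> {}"
      using assms by auto
  next
    fix \<C> assume ne: "\<C> \<noteq> {}" and ch: "subset.chain ?\<A> \<C>"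
    have sub: "\<C> \<subseteq> ?\<A>"
      using ch by (auto simp: subset.chain_def)
    have "consistent (\<Union>\<C>)"
      unfolding consistent_def
    proof (intro conjI notI)
      show "\<forall>\<phi>\<in>\<Union>\<C>. wff A AP \<phi>"
        using sub by (auto simp: consistent_def)
      assume "\<exists>xs. set xs \<subseteq> \<Union>\<C> \<and> SC A AP (Imps xs (Bot AP))"
      then obtain xs where xs: "set xs \<subseteq> \<Union>\<C>" "SC A AP (Imps xs (Bot AP))"
        by blast
      \<comment> \<open>A derivation uses only finitely many premises, and these already lie in one
        member of the chain.\<close>
      obtain C where "C \<in> \<C>" "set xs \<subseteq> C"
        using finite_subset_Union_chain[OF finite_set xs(1) ne ch] by blast
      then show False
        using sub xs(2) by (auto simp: consistent_def)
    qed
    then show "\<Union>\<C> \<in> ?\<A>"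
      using ne sub by blast
  qed
  then obtain \<Delta> where "consistent \<Delta>" "\<Gamma> \<subseteq> \<Delta>" and max: "\<forall>X\<in>?\<A>. \<Delta> \<subseteq> X \<longrightarrow> X = \<Delta>"
    by blast
  moreover have "X = \<Delta>" if "consistent X" "\<Delta> \<subseteq> X" for X
    using max that \<open>\<Gamma> \<subseteq> \<Delta>\<close> by blast
  ultimately have "mcs \<Delta>"
    unfolding mcs_def by blast
  then show thesis
    using that \<open>\<Gamma> \<subseteq> \<Delta>\<close> by blast
qed

lemma mcs_wff: "mcs \<Gamma> \<Longrightarrow> \<phi> \<in> \<Gamma> \<Longrightarrow> wff A AP \<phi>"
  by (auto simp: mcs_def consistent_def)

text \<open>By maximality it suffices that \<open>\<phi>\<close> can be added consistently. A
  refutation \<open>ys\<close> that uses \<open>\<phi>\<close> becomes one inside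
  \<open>\<Gamma>\<close> by a cut: \<open>\<phi>\<close> is replaced by the list \<open>xs\<close>
  that derives it.\<close>

lemma mcs_closed:
  assumes "mcs \<Gamma>" "set xs \<subseteq> \<Gamma>" "wff A AP \<phi>" "SC A AP (Imps xs \<phi>)"
  shows "\<phi> \<in> \<Gamma>"
proof -
  have "consistent (insert \<phi> \<Gamma>)"
    unfolding consistent_def
  proof (intro conjI notI)
    show "\<forall>\<psi>\<in>insert \<phi> \<Gamma>. wff A AP \<psi>"
      using assms mcs_wff by auto
    assume "\<exists>ys. set ys \<subseteq> insert \<phi> \<Gamma> \<and> SC A AP (Imps ys (Bot AP))"
    then obtain ys where ys: "set ys \<subseteq> insert \<phi> \<Gamma>" "SC A AP (Imps ys (Bot AP))"
      by blast
    have wf: "\<forall>y\<in>set xs \<union> set ys. wff A AP y"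
      using assms ys mcs_wff by blast
    let ?zs = "xs @ filter (\<lambda>y. y \<noteq> \<phi>) ys"
    have "SC A AP (Imps ?zs (Bot AP))"
    proof (rule SC_taut_consequence[of "[Imps xs \<phi>, Imps ys (Bot AP)]"])
      fix v assume "\<And>y. y \<in> set [Imps xs \<phi>, Imps ys (Bot AP)] \<Longrightarrow> prop_eval v y"
      from this[of "Imps xs \<phi>"] this[of "Imps ys (Bot AP)"]
      show "prop_eval v (Imps ?zs (Bot AP))"
        by (auto simp del: foldr_append)
    qed (use assms(3,4) ys(2) wf in \<open>auto simp del: foldr_append\<close>)
    moreover have "set ?zs \<subseteq> \<Gamma>"
      using assms ys by auto
    ultimately show False
      using assms(1) by (auto simp: mcs_def consistent_def simp del: foldr_append)
  qed
  then show ?thesis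
    using assms(1) unfolding mcs_def by blast
qed

lemma mcs_SC: "mcs \<Gamma> \<Longrightarrow> wff A AP \<phi> \<Longrightarrow> SC A AP \<phi> \<Longrightarrow> \<phi> \<in> \<Gamma>"
  using mcs_closed[of \<Gamma> "[]"] by simp

lemma mcs_not_Bot: "mcs \<Gamma> \<Longrightarrow> Bot AP \<notin> \<Gamma>"
proof
  assume "mcs \<Gamma>" "Bot AP \<in> \<Gamma>"
  moreover have "SC A AP (Imps [Bot AP] (Bot AP))"
    by (rule SC_taut_consequence[of "[]"]) auto
  moreover have "set [Bot AP] \<subseteq> \<Gamma>"
    using \<open>Bot AP \<in> \<Gamma>\<close> by simp
  ultimately show False
    unfolding mcs_def consistent_def by blast
qed

lemma mcs_Neg:
  assumes "mcs \<Gamma>" "wff A AP \<phi>"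
  shows "Neg \<phi> \<in> \<Gamma> \<longleftrightarrow> \<phi> \<notin> \<Gamma>"
proof
  assume neg: "Neg \<phi> \<in> \<Gamma>"
  show "\<phi> \<notin> \<Gamma>"
  proof
    assume "\<phi> \<in> \<Gamma>"
    moreover have "SC A AP (Imps [\<phi>, Neg \<phi>] (Bot AP))"
      by (rule SC_taut_consequence[of "[]"]) (use assms in auto)
    ultimately have "Bot AP \<in> \<Gamma>"
      using neg by (intro mcs_closed[OF assms(1), of "[\<phi>, Neg \<phi>]"]) auto
    then show False
      using mcs_not_Bot assms by blast
  qed
next
  assume "\<phi> \<notin> \<Gamma>"
  \<comment> \<open>Maximality gives a refutation from \<open>\<phi>\<close> and members of
    \<open>\<Gamma>\<close>; moving \<open>\<phi>\<close> to the right turns it into a derivation of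
    \<open>Neg \<phi>\<close> from \<open>\<Gamma>\<close> alone.\<close>
  then have "\<not> consistent (insert \<phi> \<Gamma>)"
    using assms unfolding mcs_def by blast
  then obtain ys where ys: "set ys \<subseteq> insert \<phi> \<Gamma>" "SC A AP (Imps ys (Bot AP))"
    using assms mcs_wff unfolding consistent_def by blast
  have wf: "\<forall>y\<in>set ys. wff A AP y"
    using assms ys mcs_wff by blast
  let ?zs = "filter (\<lambda>y. y \<noteq> \<phi>) ys"
  have "SC A AP (Imps ?zs (Neg \<phi>))"
    by (rule SC_taut_consequence[of "[Imps ys (Bot AP)]"]) (use assms ys(2) wf in auto)
  then show "Neg \<phi> \<in> \<Gamma>"
    using assms ys by (intro mcs_closed[OF assms(1), of ?zs]) auto
qed

lemma mcs_And:
  assumes "mcs \<Gamma>" "wff A AP \<phi>" "wff A AP \<psi>"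
  shows "And \<phi> \<psi> \<in> \<Gamma> \<longleftrightarrow> \<phi> \<in> \<Gamma> \<and> \<psi> \<in> \<Gamma>"
proof -
  have SC: "SC A AP (Imps [And \<phi> \<psi>] \<phi>)" "SC A AP (Imps [And \<phi> \<psi>] \<psi>)"
    "SC A AP (Imps [\<phi>, \<psi>] (And \<phi> \<psi>))"
    by (rule SC_taut_consequence[of "[]"]; use assms in auto)+
  show ?thesis
  proof
    assume "And \<phi> \<psi> \<in> \<Gamma>"
    then have "set [And \<phi> \<psi>] \<subseteq> \<Gamma>"
      by simp
    then show "\<phi> \<in> \<Gamma> \<and> \<psi> \<in> \<Gamma>"
      using mcs_closed[OF assms(1)] assms(2,3) SC(1,2) by blast
  next
    assume "\<phi> \<in> \<Gamma> \<and> \<psi> \<in> \<Gamma>"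
    then have "set [\<phi>, \<psi>] \<subseteq> \<Gamma>"
      by simp
    then show "And \<phi> \<psi> \<in> \<Gamma>"
      by (rule mcs_closed[OF assms(1) _ _ SC(3)]) (simp add: assms)
  qed
qed

text \<open>Membership in a maximal consistent set is a truth valuation, so that propositional reasoning
  inside such a set reduces to simplifying \<open>prop_eval\<close>.\<close>

lemma prop_eval_mcs:
  assumes "mcs \<Gamma>" "wff A AP \<phi>"
  shows "prop_eval (\<lambda>x. x \<in> \<Gamma>) \<phi> \<longleftrightarrow> \<phi> \<in> \<Gamma>"
  using assms(2) by (induction \<phi>) (auto simp: mcs_Neg mcs_And assms(1))

lemma mcs_Imp:
  assumes "mcs \<Gamma>" "SC A AP (Imp \<phi> \<psi>)" "wff A AP \<psi>" "\<phi> \<in> \<Gamma>"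
  shows "\<psi> \<in> \<Gamma>"
  using mcs_closed[of \<Gamma> "[\<phi>]" \<psi>] assms by auto

lemma mcs_Imp_mem:
  assumes "mcs \<Gamma>" "Imp \<phi> \<psi> \<in> \<Gamma>" "\<phi> \<in> \<Gamma>"
  shows "\<psi> \<in> \<Gamma>"
  using prop_eval_mcs[OF assms(1), of "Imp \<phi> \<psi>"] prop_eval_mcs[OF assms(1), of \<phi>]
    prop_eval_mcs[OF assms(1), of \<psi>] mcs_wff[OF assms(1,2)] assms
  by auto

lemma ex_mcs_refuting:
  assumes "wff A AP \<phi>" "\<not> SC A AP \<phi>"
  obtains \<Gamma> where "mcs \<Gamma>" "\<phi> \<notin> \<Gamma>"
proof -
  have "consistent {Neg \<phi>}"
    unfolding consistent_def
  proof (intro conjI notI)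
    assume "\<exists>xs. set xs \<subseteq> {Neg \<phi>} \<and> SC A AP (Imps xs (Bot AP))"
    then obtain xs where xs: "set xs \<subseteq> {Neg \<phi>}" "SC A AP (Imps xs (Bot AP))"
      by blast
    have "SC A AP \<phi>"
      by (rule SC_taut_consequence[of "[Imps xs (Bot AP)]"]) (use xs assms(1) in auto)
    then show False
      using assms by blast
  qed (use assms in auto)
  then obtain \<Gamma> where "mcs \<Gamma>" "{Neg \<phi>} \<subseteq> \<Gamma>"
    by (rule Lindenbaum)
  then show thesis
    using that mcs_Neg assms by auto
qed

section \<open>The canonical relations\<close>

definition R :: "'a set \<Rightarrow> ('a, 'p) fm set \<Rightarrow> ('a, 'p) fm set \<Rightarrow> bool" where
  "R B \<Gamma> \<Delta> \<longleftrightarrow> (\<forall>\<chi>. Dist B \<chi> \<in> \<Gamma> \<longrightarrow> \<chi> \<in> \<Delta>)"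

definition Live :: "('a, 'p) fm set \<Rightarrow> 'a set" where
  "Live \<Gamma> = {a \<in> A. Dist {a} (Bot AP) \<notin> \<Gamma>}"

lemma coalition_subset: "coalition A B \<Longrightarrow> B' \<noteq> {} \<Longrightarrow> B' \<subseteq> B \<Longrightarrow> coalition A B'"
  by (auto simp: coalition_def)

lemma mcs_Dist_mp:
  assumes "mcs \<Gamma>" "Dist B (Imp \<phi> \<psi>) \<in> \<Gamma>" "Dist B \<phi> \<in> \<Gamma>"
  shows "Dist B \<psi> \<in> \<Gamma>"
proof -
  have wf: "coalition A B" "wff A AP \<phi>" "wff A AP \<psi>"
    using mcs_wff[OF assms(1,2)] by (auto simp: coalition_def)
  then have "Imp (Dist B \<phi>) (Dist B \<psi>) \<in> \<Gamma>"
    using mcs_Imp[OF assms(1) SC.AxK _ assms(2)] by (simp add: coalition_def)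
  then show ?thesis
    using mcs_Imp_mem[OF assms(1) _ assms(3)] by simp
qed

text \<open>If \<open>Neg \<psi>\<close> contradicted what \<open>B\<close> knows in
  \<open>\<Gamma>\<close>, finitely many known formulas would prove \<open>\<psi>\<close>.
  Necessitation and \<open>AxK\<close>, used once for each of them, would then put
  \<open>Dist B \<psi>\<close> into \<open>\<Gamma>\<close>.\<close>

lemma R_witness:
  assumes "mcs \<Gamma>" "coalition A B" "wff A AP \<psi>" "Dist B \<psi> \<notin> \<Gamma>"
  shows "\<exists>\<Delta>. mcs \<Delta> \<and> R B \<Gamma> \<Delta> \<and> \<psi> \<notin> \<Delta>"
proof -
  let ?X = "insert (Neg \<psi>) {\<chi>. Dist B \<chi> \<in> \<Gamma>}"
  have wfX: "\<forall>x\<in>?X. wff A AP x"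
    using assms mcs_wff[OF assms(1)] by fastforce
  have "consistent ?X"
    unfolding consistent_def
  proof (intro conjI notI wfX)
    assume "\<exists>xs. set xs \<subseteq> ?X \<and> SC A AP (Imps xs (Bot AP))"
    then obtain xs where xs: "set xs \<subseteq> ?X" "SC A AP (Imps xs (Bot AP))"
      by blast
    let ?ys = "filter (\<lambda>y. y \<noteq> Neg \<psi>) xs"
    have wf: "\<forall>x\<in>set xs. wff A AP x"
      using xs wfX by blast
    have "SC A AP (Imps ?ys \<psi>)"
      by (rule SC_taut_consequence[of "[Imps xs (Bot AP)]"]) (use assms xs(2) wf in auto)
    then have "Dist B (Imps ?ys \<psi>) \<in> \<Gamma>"
      using assms wf by (intro mcs_SC SC.Nec) (auto simp: coalition_def)
    moreover have "\<forall>y\<in>set ?ys. Dist B y \<in> \<Gamma>"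
      using xs by auto
    moreover have "Dist B (Imps ys \<psi>) \<in> \<Gamma> \<Longrightarrow> \<forall>y\<in>set ys. Dist B y \<in> \<Gamma> \<Longrightarrow> Dist B \<psi> \<in> \<Gamma>" for ys
      by (induction ys) (auto dest: mcs_Dist_mp[OF assms(1)])
    ultimately show False
      using assms by blast
  qed
  then obtain \<Delta> where "mcs \<Delta>" "?X \<subseteq> \<Delta>"
    by (rule Lindenbaum)
  then show ?thesis
    using assms mcs_Neg by (auto simp: R_def)
qed

lemma R_sym:
  assumes "mcs \<Gamma>" "mcs \<Delta>" "coalition A B" "R B \<Gamma> \<Delta>"
  shows "R B \<Delta> \<Gamma>"
  unfolding R_def
proof (intro allI impI, rule ccontr)
  fix \<chi> assume \<chi>: "Dist B \<chi> \<in> \<Delta>" "\<chi> \<notin> \<Gamma>"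
  have wf: "wff A AP \<chi>"
    using mcs_wff[OF assms(2) \<chi>(1)] by simp
  then have "Neg \<chi> \<in> \<Gamma>"
    using \<chi> mcs_Neg assms by blast
  then have "Dist B (Neg (Dist B (Neg (Neg \<chi>)))) \<in> \<Gamma>"
    using mcs_Imp[OF assms(1) SC.AxB] assms(3) wf by (auto simp: coalition_def)
  then have "Dist B (Neg (Neg \<chi>)) \<notin> \<Delta>"
    using assms wf mcs_Neg[of \<Delta> "Dist B (Neg (Neg \<chi>))"] by (auto simp: R_def coalition_def)
  \<comment> \<open>\<open>AxB\<close> for \<open>Neg \<chi>\<close> speaks of a double negation
    under \<open>Dist B\<close>, so \<open>Dist B \<chi>\<close> has to be brought into that form
    inside \<open>\<Delta>\<close>.\<close>
  moreover have "SC A AP (Imp \<chi> (Neg (Neg \<chi>)))"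
    by (rule SC_taut_consequence[of "[]"]) (use wf in auto)
  then have "Dist B (Imp \<chi> (Neg (Neg \<chi>))) \<in> \<Delta>"
    using wf assms by (intro mcs_SC SC.Nec) (auto simp: coalition_def)
  ultimately show False
    using mcs_Dist_mp[OF assms(2)] \<chi> by blast
qed

lemma R_trans:
  assumes "mcs \<Gamma>" "coalition A B" "R B \<Gamma> \<Delta>" "R B \<Delta> \<Theta>"
  shows "R B \<Gamma> \<Theta>"
  unfolding R_def
proof (intro allI impI)
  fix \<chi> assume "Dist B \<chi> \<in> \<Gamma>"
  moreover from this have wf: "wff A AP \<chi>"
    using mcs_wff[OF assms(1)] by fastforce
  ultimately have "Dist B (Dist B \<chi>) \<in> \<Gamma>"
    using mcs_Imp[OF assms(1) SC.Ax4[OF assms(2) wf]] assms(2) by (simp add: coalition_def)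
  then show "\<chi> \<in> \<Theta>"
    using assms by (auto simp: R_def)
qed

lemma R_antimono:
  assumes "mcs \<Gamma>" "coalition A B'" "B \<noteq> {}" "B \<subseteq> B'" "R B' \<Gamma> \<Delta>"
  shows "R B \<Gamma> \<Delta>"
  unfolding R_def
proof (intro allI impI)
  fix \<chi> assume "Dist B \<chi> \<in> \<Gamma>"
  moreover from this have wf: "wff A AP \<chi>"
    using mcs_wff[OF assms(1)] by fastforce
  moreover have co: "coalition A B"
    using coalition_subset assms by blast
  ultimately have "Dist B' \<chi> \<in> \<Gamma>"
    using mcs_Imp[OF assms(1) SC.AxMono[OF co assms(2,4) wf]] assms(2) by (simp add: coalition_def)
  then show "\<chi> \<in> \<Delta>"
    using assms by (auto simp: R_def)
qed

text \<open>A dead member of \<open>B\<close> would force \<open>Bot AP\<close> into the successor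
  \<open>\<Delta>\<close>.\<close>

lemma R_subset_Live:
  assumes "mcs \<Gamma>" "mcs \<Delta>" "coalition A B" "R B \<Gamma> \<Delta>"
  shows "B \<subseteq> Live \<Gamma>"
proof
  fix a assume "a \<in> B"
  then have "R {a} \<Gamma> \<Delta>"
    using R_antimono[of \<Gamma> B "{a}"] assms by auto
  then show "a \<in> Live \<Gamma>"
    using mcs_not_Bot[OF assms(2)] \<open>a \<in> B\<close> assms(3) by (auto simp: R_def Live_def coalition_def)
qed

text \<open>\<open>AxUnion\<close> joins two live coalitions; induction on the finite set
  \<open>B\<close> lifts this from single agents to \<open>B\<close>.\<close>

lemma alive_if_subset_Live:
  assumes "mcs \<Gamma>" "B \<noteq> {}" "B \<subseteq> Live \<Gamma>"
  shows "Dist B (Bot AP) \<notin> \<Gamma>"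
proof -
  have "finite B"
    using assms fin by (auto simp: Live_def intro: finite_subset)
  then show ?thesis
    using assms(2,3)
  proof (induction B rule: finite_ne_induct)
    case (singleton a)
    then show ?case
      by (auto simp: Live_def)
  next
    case (insert a B)
    have co: "coalition A {a}" "coalition A B" "coalition A ({a} \<union> B)"
      using insert by (auto simp: coalition_def Live_def)
    have "Dist {a} (Bot AP) \<notin> \<Gamma>" "Dist B (Bot AP) \<notin> \<Gamma>"
      using insert by (auto simp: Live_def)
    moreover have ax: "Imp (And (alive_set AP {a}) (alive_set AP B)) (alive_set AP ({a} \<union> B)) \<in> \<Gamma>"
      using co AP_nonempty by (intro mcs_SC[OF assms(1)] SC.AxUnion) (auto simp: alive_set_def coalition_def)
    ultimately show ?case
      using prop_eval_mcs[OF assms(1) mcs_wff[OF assms(1) ax]]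
      by (auto simp: alive_set_def)
  qed
qed

text \<open>A live coalition has some successor, and the way there and back is a loop by symmetry
  and transitivity.\<close>

lemma R_refl:
  assumes "mcs \<Gamma>" "B \<noteq> {}" "B \<subseteq> Live \<Gamma>"
  shows "R B \<Gamma> \<Gamma>"
proof -
  have co: "coalition A B"
    using assms by (auto simp: coalition_def Live_def)
  obtain \<Delta> where "mcs \<Delta>" "R B \<Gamma> \<Delta>"
    using R_witness[OF assms(1) co wff_Bot' alive_if_subset_Live[OF assms]] by blast
  then show ?thesis
    using R_sym R_trans assms co by blast
qed

lemma Live_nonempty:
  assumes "mcs \<Gamma>"
  shows "Live \<Gamma> \<noteq> {}"
proof -
  have wf: "wff A AP (Disj AP A (alive AP))"
    by (intro wff_Disj fin AP_nonempty) (auto simp: alive_def dead_def K_def)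
  then have "Disj AP A (alive AP) \<in> \<Gamma>"
    by (intro mcs_SC[OF assms] SC.AxNE AP_nonempty)
  then show ?thesis
    using prop_eval_mcs[OF assms wf] by (auto simp: prop_eval_Disj fin Live_def alive_def dead_def K_def)
qed

text \<open>This is the effect of \<open>AxP\<close>: for each \<open>\<chi>\<close> in
  \<open>\<Gamma>\<close>, the live agents know that \<open>\<chi>\<close> holds if all others are
  dead, and exactly these others are dead in \<open>\<Delta>\<close>. The resulting inclusion is an
  equality because \<open>\<Gamma>\<close> is maximal.\<close>

lemma mcs_eq_if_R_Live:
  assumes "mcs \<Gamma>" "mcs \<Delta>" "Live \<Gamma> = Live \<Delta>" "R (Live \<Gamma>) \<Gamma> \<Delta>"
  shows "\<Gamma> = \<Delta>"
proof -
  have wfd: "wff A AP (dead_set AP (A - B))" for B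
    unfolding dead_set_def by (intro wff_Conj AP_nonempty) (auto simp: fin dead_def K_def)
  have dead: "dead_set AP (A - Live \<Theta>) \<in> \<Theta>" if "mcs \<Theta>" for \<Theta>
    using prop_eval_mcs[OF that wfd[of "Live \<Theta>"]]
    by (auto simp: dead_set_def prop_eval_Conj fin Live_def dead_def K_def)
  have co: "coalition A (Live \<Gamma>)"
    using Live_nonempty[OF assms(1)] by (auto simp: coalition_def Live_def)
  have sub: "\<Gamma> \<subseteq> \<Delta>"
  proof
    fix \<chi> assume \<chi>: "\<chi> \<in> \<Gamma>"
    then have wf: "wff A AP \<chi>"
      using mcs_wff assms by blast
    have "alive_set AP (Live \<Gamma>) \<in> \<Gamma>"
      using alive_if_subset_Live[OF assms(1)] Live_nonempty[OF assms(1)] mcs_Neg[OF assms(1)] co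
      by (simp add: alive_set_def coalition_def)
    then have "And (And (alive_set AP (Live \<Gamma>)) (dead_set AP (A - Live \<Gamma>))) \<chi> \<in> \<Gamma>"
      using \<chi> dead[OF assms(1)] wf co wfd mcs_And[OF assms(1)] by (simp add: alive_set_def coalition_def)
    then have "Dist (Live \<Gamma>) (Imp (dead_set AP (A - Live \<Gamma>)) \<chi>) \<in> \<Gamma>"
      using mcs_Imp[OF assms(1) SC.AxP[OF co wf]] wf wfd co by (simp add: coalition_def)
    then have "Imp (dead_set AP (A - Live \<Gamma>)) \<chi> \<in> \<Delta>"
      using assms(4) by (simp add: R_def)
    then show "\<chi> \<in> \<Delta>"
      using mcs_Imp_mem[OF assms(2)] dead[OF assms(2)] assms(3) by simp
  qed
  moreover have "consistent \<Delta>"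
    using assms(2) by (simp add: mcs_def)
  ultimately show ?thesis
    using assms(1) unfolding mcs_def by blast
qed

end

section \<open>Unravelling\<close>

primrec subf :: "('a, 'p) fm \<Rightarrow> ('a, 'p) fm set" where
  "subf (Atom p) = {Atom p}"
| "subf (Neg \<phi>) = insert (Neg \<phi>) (subf \<phi>)"
| "subf (And \<phi> \<psi>) = insert (And \<phi> \<psi>) (subf \<phi> \<union> subf \<psi>)"
| "subf (Dist B \<phi>) = insert (Dist B \<phi>) (subf \<phi>)"

lemma finite_subf: "finite (subf \<phi>)"
  by (induction \<phi>) auto

lemma subf_refl: "\<phi> \<in> subf \<phi>"
  by (cases \<phi>) auto

lemma subf_trans: "\<psi> \<in> subf \<phi> \<Longrightarrow> subf \<psi> \<subseteq> subf \<phi>"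
  by (induction \<phi>) auto

lemma wff_subf: "wff A AP \<phi> \<Longrightarrow> \<psi> \<in> subf \<phi> \<Longrightarrow> wff A AP \<psi>"
  by (induction \<phi>) auto

text \<open>Lists grow at the head, so the tail of a path is its parent, and \<open>root B w\<close> is the topmost
  ancestor of \<open>w\<close> that can be reached through edges whose label includes \<open>B\<close>.\<close>

abbreviation root :: "'a set \<Rightarrow> ('a set \<times> 'b) list \<Rightarrow> ('a set \<times> 'b) list" where
  "root B \<equiv> dropWhile (\<lambda>s. B \<subseteq> fst s)"

text \<open>The climb for \<open>B\<close> stops at the first edge whose label lacks some
  \<open>a\<close> in \<open>B\<close>, and \<open>a\<close> alone stops at the same edge. If the
  climb reaches the top, any member of \<open>B\<close> will do.\<close>

lemma root_eq_root_member:
  assumes "B \<noteq> {}"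
  obtains a where "a \<in> B" "root B w = root {a} w"
proof -
  have "\<exists>a\<in>B. root B w = root {a} w"
    by (induction w) (use assms in auto)
  then show thesis
    using that by blast
qed

lemma length_root_member: "a \<in> B \<Longrightarrow> length (root {a} w) \<le> length (root B w)"
  by (induction w) (auto simp: length_dropWhile_le le_SucI)

text \<open>This expresses that there is only one way between two nodes. Choose members
  \<open>a\<close> and \<open>b\<close> that stop where \<open>B\<close> stops from \<open>w\<close>
  and from \<open>v\<close>. A single member climbs at least as far as \<open>B\<close>, so
  comparing both ways gives equal lengths, and two suffixes of \<open>w\<close> of equal length
  coincide.\<close>

lemma root_eq_if_root_members_eq:
  assumes "B \<noteq> {}" and eq: "\<And>a. a \<in> B \<Longrightarrow> root {a} w = root {a} v"
  shows "root B w = root B v"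
proof -
  obtain a b where a: "a \<in> B" "root B w = root {a} w" and b: "b \<in> B" "root B v = root {b} v"
    using root_eq_root_member[OF assms(1)] by metis
  have "length (root B w) = length (root B v)"
    using length_root_member[OF a(1), of v] length_root_member[OF b(1), of w] a b eq
    by (metis le_antisym)
  moreover have "suffix (root B w) w" "suffix (root B v) w"
    using a b eq suffix_dropWhile by metis+
  ultimately show ?thesis
    by (metis suffix_length_suffix le_refl suffix_order.antisym)
qed

section \<open>The tree of refuted subformulas\<close>

locale refutation = finite_agents A AP for A :: "'a set" and AP :: "'p set" +
  fixes \<phi> :: "('a, 'p) fm" and \<Gamma>\<^sub>0 :: "('a, 'p) fm set"
  assumes wff_phi: "wff A AP \<phi>" and mcs_Gamma0: "mcs \<Gamma>\<^sub>0"
begin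

text \<open>The choice is made on all lists, but a witness is guaranteed only along
  \<open>paths\<close>, where \<open>Dist B \<psi>\<close> is refuted at the parent.\<close>

fun node :: "('a set \<times> ('a, 'p) fm) list \<Rightarrow> ('a, 'p) fm set" where
  "node [] = \<Gamma>\<^sub>0"
| "node ((B, \<psi>) # w) = (SOME \<Delta>. mcs \<Delta> \<and> R B (node w) \<Delta> \<and> \<psi> \<notin> \<Delta>)"

inductive_set paths :: "('a set \<times> ('a, 'p) fm) list set" where
  Nil: "[] \<in> paths"
| Cons: "w \<in> paths \<Longrightarrow> Dist B \<psi> \<in> subf \<phi> \<Longrightarrow> Dist B \<psi> \<notin> node w \<Longrightarrow> (B, \<psi>) # w \<in> paths"

lemma wff_step: "Dist B \<psi> \<in> subf \<phi> \<Longrightarrow> coalition A B \<and> wff A AP \<psi>"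
  using wff_subf[OF wff_phi] by (fastforce simp: coalition_def)

lemma node_Cons:
  assumes "mcs (node w)" "Dist B \<psi> \<in> subf \<phi>" "Dist B \<psi> \<notin> node w"
  shows "mcs (node ((B, \<psi>) # w)) \<and> R B (node w) (node ((B, \<psi>) # w)) \<and> \<psi> \<notin> node ((B, \<psi>) # w)"
  using someI_ex[OF R_witness[OF assms(1) _ _ assms(3)]] wff_step[OF assms(2)] by simp

lemma mcs_node: "w \<in> paths \<Longrightarrow> mcs (node w)"
  by (induction rule: paths.induct) (use mcs_Gamma0 node_Cons in auto)

lemma countable_paths: "countable paths"
proof -
  \<comment> \<open>A finite set that contains all edges; the value at formulas other than
    \<open>Dist\<close> is a dummy.\<close>
  let ?S = "(\<lambda>x. case x of Dist B \<psi> \<Rightarrow> (B, \<psi>) | _ \<Rightarrow> ({}, x)) ` subf \<phi>"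
  have "w \<in> lists ?S" if "w \<in> paths" for w
    using that by induction (auto simp: image_iff intro!: bexI)
  moreover have "countable (lists ?S)"
    using finite_subf by (intro countable_lists countable_finite) auto
  ultimately show ?thesis
    by (meson countable_subset subsetI)
qed

text \<open>An edge whose label includes \<open>B\<close> carries \<open>R B\<close> by
  antimonotonicity, and it can be climbed by symmetry. Where the climb stops at once,
  \<open>R_refl\<close> applies, which needs \<open>B\<close> to be alive.\<close>

lemma R_node_root:
  assumes "w \<in> paths" "B \<noteq> {}" "B \<subseteq> Live (node w)"
  shows "root B w \<in> paths \<and> R B (node w) (node (root B w))"
  using assms
proof (induction rule: paths.induct)
  case Nil
  then show ?case
    using R_refl mcs_Gamma0 by (auto intro: paths.Nil)
next
  case (Cons w C \<psi>)
  have p: "(C, \<psi>) # w \<in> paths"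
    using Cons by (intro paths.Cons)
  show ?case
  proof (cases "B \<subseteq> C")
    case True
    have co: "coalition A C" "coalition A B"
      using Cons wff_step coalition_subset True by blast+
    have "R C (node w) (node ((C, \<psi>) # w))"
      using node_Cons Cons mcs_node by blast
    then have r: "R B (node w) (node ((C, \<psi>) # w))"
      using R_antimono[OF mcs_node[OF Cons.hyps(1)] co(1) Cons.prems(1) True] by blast
    \<comment> \<open>Liveness passes along the edge to the parent, as the induction hypothesis
      requires.\<close>
    then have "B \<subseteq> Live (node w)"
      using R_subset_Live[OF mcs_node[OF Cons.hyps(1)] mcs_node[OF p] co(2)] by blast
    then have "root B w \<in> paths" "R B (node w) (node (root B w))"
      using Cons by blast+
    moreover have "R B (node ((C, \<psi>) # w)) (node w)"
      using R_sym[OF mcs_node[OF Cons.hyps(1)] mcs_node[OF p] co(2) r] .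
    ultimately show ?thesis
      using R_trans[OF mcs_node[OF p] co(2)] True by (simp del: node.simps)
  next
    case False
    then show ?thesis
      using p R_refl mcs_node Cons.prems by (simp del: node.simps)
  qed
qed

text \<open>Equal roots mean that the edges between \<open>w\<close> and \<open>v\<close> all carry
  \<open>a\<close>. Without the liveness conditions even a dead agent would relate each node to
  itself.\<close>

definition sim :: "'a \<Rightarrow> ('a set \<times> ('a, 'p) fm) list \<Rightarrow> ('a set \<times> ('a, 'p) fm) list \<Rightarrow> bool" where
  "sim a w v \<longleftrightarrow> a \<in> Live (node w) \<and> a \<in> Live (node v) \<and> root {a} w = root {a} v"

lemma sim_sym: "sim a w v \<Longrightarrow> sim a v w"
  by (simp add: sim_def)

lemma sim_trans: "sim a w v \<Longrightarrow> sim a v u \<Longrightarrow> sim a w u"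
  by (simp add: sim_def)

text \<open>The relations of the single members determine one common root for the whole of
  \<open>B\<close>; \<open>R B\<close> leads from \<open>w\<close> up to it and from there down to
  \<open>v\<close>.\<close>

lemma sim_imp_R:
  assumes "w \<in> paths" "v \<in> paths" "B \<noteq> {}" and sim: "\<And>a. a \<in> B \<Longrightarrow> sim a w v"
  shows "R B (node w) (node v)"
proof -
  have sub: "B \<subseteq> Live (node w)" "B \<subseteq> Live (node v)"
    using sim by (auto simp: sim_def)
  have co: "coalition A B"
    using sub assms(3) by (auto simp: coalition_def Live_def)
  have "root B w = root B v"
    using root_eq_if_root_members_eq[OF assms(3)] sim unfolding sim_def by blast
  then have "R B (node w) (node (root B v))" "R B (node v) (node (root B v))" "root B v \<in> paths"
    using R_node_root assms sub by metis+
  then show ?thesis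
    using R_sym R_trans mcs_node assms co by meson
qed

lemma sim_Cons:
  assumes "w \<in> paths" "(B, \<psi>) # w \<in> paths" "a \<in> B"
  shows "sim a w ((B, \<psi>) # w)"
proof -
  have st: "Dist B \<psi> \<in> subf \<phi>" "Dist B \<psi> \<notin> node w"
    using assms(2) by (auto elim: paths.cases)
  have co: "coalition A B" and r: "R B (node w) (node ((B, \<psi>) # w))"
    using st node_Cons mcs_node assms(1) wff_step by blast+
  have "a \<in> Live (node w)" "a \<in> Live (node ((B, \<psi>) # w))"
    using R_subset_Live[OF _ _ co] R_sym[OF _ _ co] r mcs_node assms by blast+
  then show ?thesis
    using assms(3) by (simp add: sim_def del: node.simps)
qed

section \<open>Identification of the nodes that violate properness\<close>

definition equi :: "('a set \<times> ('a, 'p) fm) list \<Rightarrow> ('a set \<times> ('a, 'p) fm) list \<Rightarrow> bool" where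
  "equi w v \<longleftrightarrow> Live (node w) = Live (node v) \<and> (\<forall>a\<in>Live (node w). sim a w v)"

lemma equi_refl: "equi w w"
  by (simp add: equi_def sim_def)

lemma equi_sym: "equi w v \<Longrightarrow> equi v w"
  by (auto simp: equi_def intro: sim_sym)

lemma equi_trans: "equi w v \<Longrightarrow> equi v u \<Longrightarrow> equi w u"
  unfolding equi_def using sim_trans by metis

text \<open>Together with \<open>equi_imp_node_eq\<close>, this makes relations and valuation
  independent of the node that represents a world.\<close>

lemma sim_cong_equi: "equi w w' \<Longrightarrow> equi v v' \<Longrightarrow> sim a w v \<longleftrightarrow> sim a w' v'"
  unfolding equi_def sim_def by auto

lemma equi_imp_node_eq:
  assumes "w \<in> paths" "v \<in> paths" "equi w v"
  shows "node w = node v"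
  using assms mcs_eq_if_R_Live[OF mcs_node mcs_node] sim_imp_R Live_nonempty mcs_node
  by (simp add: equi_def)

section \<open>The countermodel\<close>

text \<open>The quotient is given by any map \<open>h\<close> with kernel \<open>equi\<close>, so
  that the worlds may live in a prescribed type.\<close>

context
  fixes h :: "('a set \<times> ('a, 'p) fm) list \<Rightarrow> 'w"
  assumes h_eq_iff: "\<And>w v. w \<in> paths \<Longrightarrow> v \<in> paths \<Longrightarrow> h w = h v \<longleftrightarrow> equi w v"
begin

definition quotient_model :: "('w, 'a, 'p) model" where
  "quotient_model =
     \<lparr>worlds = h ` paths,
      rel = (\<lambda>a. {(h w, h v) | w v. w \<in> paths \<and> v \<in> paths \<and> sim a w v}),
      val = (\<lambda>x. {p \<in> AP. \<exists>w\<in>paths. h w = x \<and> Atom p \<in> node w})\<rparr>"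

lemma worlds_quotient: "worlds quotient_model = h ` paths"
  by (simp add: quotient_model_def)

lemma rel_quotient:
  assumes "w \<in> paths" "v \<in> paths"
  shows "(h w, h v) \<in> rel quotient_model a \<longleftrightarrow> sim a w v"
proof
  assume "(h w, h v) \<in> rel quotient_model a"
  then obtain w' v' where *: "w' \<in> paths" "v' \<in> paths" "sim a w' v'" "h w = h w'" "h v = h v'"
    by (auto simp: quotient_model_def)
  then have "equi w w'" "equi v v'"
    using h_eq_iff assms by blast+
  then show "sim a w v"
    using sim_cong_equi * by blast
qed (use assms in \<open>auto simp: quotient_model_def\<close>)

lemma val_quotient:
  assumes "w \<in> paths"
  shows "val quotient_model (h w) = {p \<in> AP. Atom p \<in> node w}"
proof -
  have "node v = node w" if "v \<in> paths" "h v = h w" for v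
    using that assms h_eq_iff equi_imp_node_eq by blast
  then have "(\<exists>v\<in>paths. h v = h w \<and> Atom p \<in> node v) \<longleftrightarrow> Atom p \<in> node w" for p
    using assms by metis
  then show ?thesis
    by (simp add: quotient_model_def)
qed

lemma live_quotient:
  assumes "w \<in> paths"
  shows "live A quotient_model (h w) = Live (node w)"
  using assms by (auto simp: live_def rel_quotient sim_def Live_def)

lemma quotient_partial_epistemic: "partial_epistemic_model A AP quotient_model"
proof -
  have "rel quotient_model a \<subseteq> worlds quotient_model \<times> worlds quotient_model" for a
    by (auto simp: quotient_model_def)
  moreover have "sym (rel quotient_model a)" for a
    by (auto simp: quotient_model_def sym_def dest: sim_sym)
  moreover have "trans (rel quotient_model a)" for a
  proof (rule transI)
    fix x y z assume *: "(x, y) \<in> rel quotient_model a" "(y, z) \<in> rel quotient_model a"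
    then obtain w v u where "x = h w" "y = h v" "z = h u" "w \<in> paths" "v \<in> paths" "u \<in> paths"
      by (auto simp: quotient_model_def)
    then show "(x, z) \<in> rel quotient_model a"
      using * sim_trans[of a w v u] by (simp add: rel_quotient)
  qed
  ultimately show ?thesis
    by (auto simp: partial_epistemic_model_def worlds_quotient val_quotient)
qed

lemma quotient_no_empty_world: "no_empty_world A quotient_model"
  by (auto simp: no_empty_world_def worlds_quotient live_quotient dest: Live_nonempty[OF mcs_node])

text \<open>Holds by construction: distinct worlds come from nodes that are not \<open>equi\<close>,
  so if they have the same live agents, one of these separates them.\<close>

lemma quotient_proper: "proper A quotient_model"
  by (auto simp: proper_def worlds_quotient live_quotient rel_quotient h_eq_iff equi_def)

text \<open>The restriction to subformulas of \<open>\<phi>\<close> matches the tree, where only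
  these have refuting edges.\<close>

lemma truth_lemma:
  assumes "\<psi> \<in> subf \<phi>" "w \<in> paths"
  shows "sat quotient_model (h w) \<psi> \<longleftrightarrow> \<psi> \<in> node w"
  using assms
proof (induction \<psi> arbitrary: w)
  case (Atom p)
  then show ?case
    using wff_subf[OF wff_phi Atom(1)] by (simp add: val_quotient)
next
  case (Neg \<psi>)
  then have "\<psi> \<in> subf \<phi>"
    using subf_trans subf_refl by fastforce
  then show ?case
    using Neg mcs_Neg[OF mcs_node] wff_subf[OF wff_phi] by simp
next
  case (And \<psi> \<chi>)
  then have "\<psi> \<in> subf \<phi>" "\<chi> \<in> subf \<phi>"
    using subf_trans subf_refl by fastforce+
  then show ?case
    using And mcs_And[OF mcs_node] wff_subf[OF wff_phi] by simp
next
  case (Dist B \<psi>)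
  then have sub: "\<psi> \<in> subf \<phi>"
    using subf_trans subf_refl by fastforce
  have ne: "B \<noteq> {}"
    using wff_step[OF Dist.prems(1)] by (simp add: coalition_def)
  have "sat quotient_model (h w) (Dist B \<psi>) \<longleftrightarrow>
      (\<forall>v\<in>paths. (\<forall>a\<in>B. sim a w v) \<longrightarrow> \<psi> \<in> node v)"
    using Dist.IH[OF sub] Dist.prems(2) by (simp add: worlds_quotient rel_quotient)
  also have "\<dots> \<longleftrightarrow> Dist B \<psi> \<in> node w"
  proof
    assume all: "\<forall>v\<in>paths. (\<forall>a\<in>B. sim a w v) \<longrightarrow> \<psi> \<in> node v"
    show "Dist B \<psi> \<in> node w"
    proof (rule ccontr)
      assume n: "Dist B \<psi> \<notin> node w"
      \<comment> \<open>The child along this edge is the counterexample: it refutes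
        \<open>\<psi>\<close> and every member of \<open>B\<close> relates it to
        \<open>w\<close>.\<close>
      then have p: "(B, \<psi>) # w \<in> paths"
        using Dist.prems by (intro paths.Cons)
      then have "\<psi> \<in> node ((B, \<psi>) # w)"
        using all sim_Cons Dist.prems by blast
      then show False
        using node_Cons n mcs_node Dist.prems by blast
    qed
  next
    assume "Dist B \<psi> \<in> node w"
    \<comment> \<open>Here the intersection of the members' relations must lie inside
      \<open>R B\<close>, which is what the tree shape provides.\<close>
    then show "\<forall>v\<in>paths. (\<forall>a\<in>B. sim a w v) \<longrightarrow> \<psi> \<in> node v"
      using sim_imp_R[OF Dist.prems(2) _ ne] by (auto simp: R_def)
  qed
  finally show ?case .
qed

end

section \<open>Embedding the countably many classes into the given type\<close>

lemma ex_equi_quotient_map: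
  assumes "infinite (UNIV :: 'w set)"
  obtains h :: "('a set \<times> ('a, 'p) fm) list \<Rightarrow> 'w"
  where "\<And>w v. w \<in> paths \<Longrightarrow> v \<in> paths \<Longrightarrow> h w = h v \<longleftrightarrow> equi w v"
proof -
  define cls where "cls w = {v \<in> paths. equi w v}" for w
  have cls: "cls w = cls v \<longleftrightarrow> equi w v" if "w \<in> paths" "v \<in> paths" for w v
    using that equi_refl equi_sym equi_trans unfolding cls_def by blast
  obtain f :: "nat \<Rightarrow> 'w" where "inj f"
    using infinite_countable_subset[OF assms] by blast
  moreover have "inj_on (to_nat_on (cls ` paths)) (cls ` paths)"
    using countable_paths by (intro inj_on_to_nat_on) auto
  \<comment> \<open>A class is first numbered by a natural number, which \<open>f\<close> then sends
    injectively into the type of worlds.\<close>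
  ultimately have "f (to_nat_on (cls ` paths) (cls w)) = f (to_nat_on (cls ` paths) (cls v)) \<longleftrightarrow> equi w v"
    if "w \<in> paths" "v \<in> paths" for w v
    using that by (auto simp: inj_eq inj_on_eq_iff cls)
  then show thesis
    by (rule that)
qed

text \<open>The empty path is labelled with \<open>\<Gamma>\<^sub>0\<close>, so by the truth lemma
  its world refutes \<open>\<phi>\<close>.\<close>

lemma not_valid_proper:
  assumes "infinite (UNIV :: 'w set)" "\<phi> \<notin> \<Gamma>\<^sub>0"
  shows "\<not> valid_proper TYPE('w) A AP \<phi>"
proof -
  obtain h :: "('a set \<times> ('a, 'p) fm) list \<Rightarrow> 'w"
    where h: "\<And>w v. w \<in> paths \<Longrightarrow> v \<in> paths \<Longrightarrow> h w = h v \<longleftrightarrow> equi w v"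
    using ex_equi_quotient_map[OF assms(1)] by blast
  have "\<not> sat (quotient_model h) (h []) \<phi>"
    using truth_lemma[OF h subf_refl paths.Nil] assms(2) by simp
  moreover have "h [] \<in> worlds (quotient_model h)"
    using worlds_quotient[OF h] paths.Nil by simp
  ultimately show ?thesis
    using quotient_partial_epistemic[OF h] quotient_no_empty_world[OF h] quotient_proper[OF h]
    unfolding valid_proper_def by blast
qed

end

theorem theorem47:
  fixes A :: "'a set" and AP :: "'p set" and \<phi> :: "('a, 'p) fm"
  assumes "finite A"
    and "countable AP"
    and "infinite (UNIV :: 'w set)"
    and "wff A AP \<phi>"
    and "valid_proper TYPE('w) A AP \<phi>"
  shows "SC A AP \<phi>"
proof (rule ccontr)
  assume "\<not> SC A AP \<phi>"
  interpret finite_agents A AP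
    using assms(1,4) AP_nonempty_if_wff by unfold_locales blast+
  obtain \<Gamma> where "mcs \<Gamma>" "\<phi> \<notin> \<Gamma>"
    using ex_mcs_refuting assms(4) \<open>\<not> SC A AP \<phi>\<close> by blast
  interpret refutation A AP \<phi> \<Gamma>
    using assms(4) \<open>mcs \<Gamma>\<close> by unfold_locales
  show False
    using not_valid_proper[OF assms(3) \<open>\<phi> \<notin> \<Gamma>\<close>] assms(5) by blast
qed

end
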